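(* Every finite nilpotent group is good.
   Context: A finite conjugacy class $C$ of a group $G$ is good in $G$ if for every $c\in C$ there is $z\in C$ such that $\langle c\rangle\cap C_G(z)\leq Z(\langle C\rangle)$, where $\langle C\rangle$ is the subgroup of $G$ generated by $C$, $C_G(z)$ is the centralizer of $z$ in $G$, and $Z(\cdot)$ denotes the center. A group $G$ is good if all of its finite conjugacy classes are good in $G$. *)

theory Defs
  imports "HOL-Algebra.Generated_Groups"
begin

definition group_center :: "('a, 'b) monoid_scheme \<Rightarrow> 'a set" where
  "group_center G = {z \<in> carrier G. \<forall>x \<in> carrier G. z \<otimes>\<^bsub>G\<^esub> x = x \<otimes>\<^bsub>G\<^esub> z}"

definition centralizer :: "('a, 'b) monoid_scheme \<Rightarrow> 'a \<Rightarrow> 'a set" where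
  "centralizer G z = {x \<in> carrier G. x \<otimes>\<^bsub>G\<^esub> z = z \<otimes>\<^bsub>G\<^esub> x}"

definition conjugacy_class :: "('a, 'b) monoid_scheme \<Rightarrow> 'a \<Rightarrow> 'a set" where
  "conjugacy_class G x = (\<lambda>g. g \<otimes>\<^bsub>G\<^esub> x \<otimes>\<^bsub>G\<^esub> inv\<^bsub>G\<^esub> g) ` carrier G"

definition conjugacy_classes :: "('a, 'b) monoid_scheme \<Rightarrow> 'a set set" where
  "conjugacy_classes G = conjugacy_class G ` carrier G"

(* The center on the right is that of the group generated by C, not of G. *)
definition good_conjugacy_class :: "('a, 'b) monoid_scheme \<Rightarrow> 'a set \<Rightarrow> bool" where
  "good_conjugacy_class G C \<longleftrightarrow>
     (\<forall>c \<in> C. \<exists>z \<in> C.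
        generate G {c} \<inter> centralizer G z \<subseteq> group_center (subgroup_generated G C))"

definition good_group :: "('a, 'b) monoid_scheme \<Rightarrow> bool" where
  "good_group G \<longleftrightarrow>
     (\<forall>C \<in> conjugacy_classes G. finite C \<longrightarrow> good_conjugacy_class G C)"

(* The index starts at 0: lower_central_series G n is usually written gamma_(n+1)(G).
   The commutator convention is that of derived_set. *)
primrec lower_central_series :: "('a, 'b) monoid_scheme \<Rightarrow> nat \<Rightarrow> 'a set" where
  "lower_central_series G 0 = carrier G"
| "lower_central_series G (Suc n) =
     generate G (\<Union>x \<in> carrier G. \<Union>y \<in> lower_central_series G n.
       {x \<otimes>\<^bsub>G\<^esub> y \<otimes>\<^bsub>G\<^esub> inv\<^bsub>G\<^esub> x \<otimes>\<^bsub>G\<^esub> inv\<^bsub>G\<^esub> y})"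

definition nilpotent_group :: "('a, 'b) monoid_scheme \<Rightarrow> bool" where
  "nilpotent_group G \<longleftrightarrow> (\<exists>n. lower_central_series G n = {\<one>\<^bsub>G\<^esub>})"

end

theory Submission
  imports Defs "HOL-Algebra.Multiplicative_Group" "HOL-Computational_Algebra.Primes"
begin

text \<open>Elements of coprime order commute in a nilpotent group, so conjugating a \<open>p\<close>-element depends
only on the \<open>p\<close>-part of the conjugating element. Since the \<open>p\<close>-elements of \<open>\<langle>c\<rangle>\<close> form
a cyclic \<open>p\<close>-group, its subgroups form a chain, and for each prime \<open>p\<close> some \<open>z \<in> C\<close> is such that
every \<open>p\<close>-element of \<open>\<langle>c\<rangle>\<close> commuting with \<open>z\<close> centralizes \<open>C\<close>. The conjugating elements
found for the finitely many relevant primes are glued together along their \<open>p\<close>-parts, and an element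
of \<open>\<langle>c\<rangle>\<close> is a product of powers of itself of prime power order.\<close>

context group
begin

section \<open>Centralizers and conjugation\<close>

lemma inv_cancel_left:
  assumes "x \<in> carrier G" "y \<in> carrier G"
  shows "inv x \<otimes> (x \<otimes> y) = y" "x \<otimes> (inv x \<otimes> y) = y"
  using assms by (simp_all flip: m_assoc)

lemma subgroup_centralizer:
  assumes z: "z \<in> carrier G"
  shows "subgroup (centralizer G z) G"
proof (rule subgroupI)
  show "centralizer G z \<subseteq> carrier G" by (auto simp: centralizer_def)
  show "centralizer G z \<noteq> {}" using z by (auto simp: centralizer_def)
next
  fix a assume "a \<in> centralizer G z"
  then have a: "a \<in> carrier G" "a \<otimes> z = z \<otimes> a" by (auto simp: centralizer_def)
  have "z \<otimes> inv a = inv a \<otimes> (a \<otimes> z) \<otimes> inv a"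
    using a(1) z by (simp add: m_assoc inv_cancel_left)
  also have "\<dots> = inv a \<otimes> z" unfolding a(2) using a(1) z by (simp add: m_assoc)
  finally have "z \<otimes> inv a = inv a \<otimes> z" .
  then show "inv a \<in> centralizer G z" using a by (simp add: centralizer_def)
next
  fix a b assume "a \<in> centralizer G z" "b \<in> centralizer G z"
  then have ab: "a \<in> carrier G" "a \<otimes> z = z \<otimes> a" "b \<in> carrier G" "b \<otimes> z = z \<otimes> b"
    by (auto simp: centralizer_def)
  have "a \<otimes> b \<otimes> z = z \<otimes> (a \<otimes> b)" using ab z by (metis m_assoc)
  then show "a \<otimes> b \<in> centralizer G z" using ab by (simp add: centralizer_def)
qed

text \<open>Conjugation by \<open>inv g\<close> carries one condition to the other. The right-hand
  side involves \<open>g\<close> only through \<open>inv g \<otimes> x \<otimes> g\<close>, so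
  conjugators acting alike on \<open>x\<close> are interchangeable.\<close>

lemma mem_centralizer_conj:
  assumes "x \<in> carrier G" "g \<in> carrier G" "c \<in> carrier G"
  shows "x \<in> centralizer G (g \<otimes> c \<otimes> inv g) \<longleftrightarrow> inv g \<otimes> x \<otimes> g \<in> centralizer G c"
proof -
  have "x \<otimes> (g \<otimes> c \<otimes> inv g) = g \<otimes> c \<otimes> inv g \<otimes> x \<longleftrightarrow>
        inv g \<otimes> (x \<otimes> (g \<otimes> c \<otimes> inv g)) \<otimes> g = inv g \<otimes> (g \<otimes> c \<otimes> inv g \<otimes> x) \<otimes> g"
    using assms by simp
  also have "inv g \<otimes> (x \<otimes> (g \<otimes> c \<otimes> inv g)) \<otimes> g = inv g \<otimes> x \<otimes> g \<otimes> c"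
    using assms by (simp add: m_assoc inv_cancel_left)
  also have "inv g \<otimes> (g \<otimes> c \<otimes> inv g \<otimes> x) \<otimes> g = c \<otimes> (inv g \<otimes> x \<otimes> g)"
    using assms by (simp add: m_assoc inv_cancel_left)
  finally show ?thesis using assms by (simp add: centralizer_def)
qed

section \<open>Orders of elements, primary parts and cyclic subgroups\<close>

lemma eq_one_if_coprime_pows:
  fixes a b :: nat
  assumes "coprime a b" "x \<in> carrier G" "x [^] a = \<one>" "x [^] b = \<one>"
  shows "x = \<one>"
proof -
  have "ord x dvd a" "ord x dvd b" using assms pow_eq_id by auto
  then have "ord x = 1" using assms(1) by (metis coprime_common_divisor_nat)
  then show ?thesis using assms(2) pow_ord_eq_1[of x] by simp
qed

text \<open>Bezout's identity splits the exponent 1 into a multiple of \<open>b\<close> and a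
  multiple of \<open>a\<close>. Both factors are powers of \<open>x\<close>, so they lie in every
  subgroup containing \<open>x\<close>.\<close>

lemma coprime_power_decomp:
  fixes a b :: nat
  assumes "coprime a b" "x \<in> carrier G" "x [^] (a * b) = \<one>"
  obtains u v :: int where "x = x [^] u \<otimes> x [^] v" "(x [^] u) [^] a = \<one>" "(x [^] v) [^] b = \<one>"
proof -
  obtain u v :: int where uv: "u * int a + v * int b = 1"
    using bezout_int[of "int a" "int b"] assms(1) by auto
  have x1: "x [^] (int (a * b) * k) = \<one>" for k
    using assms int_pow_pow[of x "int (a * b)" k] by (simp add: int_pow_int del: of_nat_mult)
  show ?thesis
  proof
    \<comment> \<open>The roles cross over: the exponent divisible by \<open>b\<close> gives the
      factor killed by \<open>a\<close>.\<close>
    show "x = x [^] (v * int b) \<otimes> x [^] (u * int a)"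
      using uv assms(2) by (simp add: int_pow_mult[symmetric] add.commute)
    show "(x [^] (v * int b)) [^] a = \<one>"
      using x1[of v] assms(2) int_pow_pow[of x "v * int b" "int a"]
      by (simp add: int_pow_int mult_ac)
    show "(x [^] (u * int a)) [^] b = \<one>"
      using x1[of u] assms(2) int_pow_pow[of x "u * int a" "int b"]
      by (simp add: int_pow_int mult_ac)
  qed
qed

text \<open>Strong induction on \<open>n\<close>: the full power of a prime divisor is split off,
  which leaves a power of \<open>x\<close> killed by the smaller cofactor.\<close>

lemma mem_subgroup_if_primary_powers:
  assumes H: "subgroup H G" and x: "x \<in> carrier G" and n: "x [^] (n::nat) = \<one>" "n > 0"
    and primary: "\<And>(p::nat) k i. prime p \<Longrightarrow> (x [^] (i::int)) [^] (p ^ k) = \<one> \<Longrightarrow> x [^] i \<in> H"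
  shows "x \<in> H"
  using x n primary
proof (induction n arbitrary: x rule: less_induct)
  case (less n)
  show ?case
  proof (cases "n = 1")
    case True
    then show ?thesis using less.prems H by (simp add: subgroup.one_closed)
  next
    case False
    then obtain p where p: "prime p" "p dvd n" using prime_factor_nat by blast
    obtain m where m: "n = p ^ multiplicity p n * m" "\<not> p dvd m"
      using multiplicity_decompose'[of n p] less.prems p by (metis not_prime_unit neq0_conv)
    define k where "k = multiplicity p n"
    have cop: "coprime (p ^ k) m" using p m by (simp add: prime_imp_coprime)
    have k: "k > 0" using p less.prems by (simp add: k_def prime_multiplicity_gt_zero_iff)
    have m0: "m > 0" using m less.prems by (cases m) auto
    have "1 < p ^ k" by (rule one_less_power[OF prime_gt_1_nat[OF p(1)] k])
    then have mn: "m < n" using m m0 by (metis k_def mult.left_neutral mult_less_mono1)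
    have "x [^] (p ^ k * m) = \<one>" using less.prems m by (simp add: k_def)
    then obtain u v :: int where uv: "x = x [^] u \<otimes> x [^] v"
      "(x [^] u) [^] (p ^ k) = \<one>" "(x [^] v) [^] m = \<one>"
      using coprime_power_decomp[OF cop \<open>x \<in> carrier G\<close>] by blast
    have "x [^] u \<in> H" using less.prems(4) p(1) uv(2) by blast
    moreover have "x [^] v \<in> H"
    proof (rule less.IH[OF mn _ uv(3) m0])
      show "x [^] v \<in> carrier G" using less.prems by simp
      \<comment> \<open>Powers of \<open>x [^] v\<close> are powers of \<open>x\<close>, so the
        assumption on primary powers is inherited.\<close>
      fix q l i assume "prime (q::nat)" "((x [^] v) [^] (i::int)) [^] (q ^ l :: nat) = \<one>"
      then show "(x [^] v) [^] i \<in> H"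
        using less.prems(1,4) by (metis int_pow_pow)
    qed
    ultimately show ?thesis using uv(1) H subgroup.m_closed by metis
  qed
qed

text \<open>A finite cyclic group has only one subgroup of each possible order, and that subgroup
  contains all solutions of \<open>w [^] ord x = \<one>\<close>. This is the source of the chain
  property in the prime power case.\<close>

lemma generate_mem_if_pow_ord:
  assumes c: "c \<in> carrier G" "ord c > 0"
    and x: "x \<in> generate G {c}" and w: "w \<in> generate G {c}" and wx: "w [^] ord x = \<one>"
  shows "w \<in> generate G {x}"
proof -
  obtain i j :: int where ij: "x = c [^] i" "w = c [^] j"
    using x w generate_pow[OF c(1)] by auto
  \<comment> \<open>The subgroup generated by \<open>x\<close> is also generated by
    \<open>c [^] g\<close>. It thus suffices to show that \<open>g\<close> divides \<open>j\<close>;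
    Bezout then rewrites \<open>c [^] j\<close> as a power of \<open>x\<close>.\<close>
  define g where "g = gcd i (int (ord c))"
  have g0: "g > 0" using c by (simp add: g_def)
  obtain N where N: "int (ord c) = g * N" by (metis dvdE gcd_dvd2 g_def)
  obtain i' where i': "i = g * i'" by (metis dvdE gcd_dvd1 g_def)
  have N0: "N > 0" using N g0 c by (metis of_nat_0_less_iff zero_less_mult_pos)
  have "x [^] N = \<one>"
    using c int_pow_eq_id[of c "i * N"] by (simp add: ij int_pow_pow i' N)
  then obtain k where k: "N = int (ord x) * k"
    using int_pow_eq_id[of x N] ij c by auto
  have "c [^] (j * int (ord x)) = \<one>"
    using wx ij c int_pow_pow[of c j "int (ord x)"] by (simp add: int_pow_int)
  then have "g * (int (ord x) * k) dvd j * int (ord x)"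
    using int_pow_eq_id[of c] c N k by simp
  then have "int (ord x) * (g * k) dvd int (ord x) * j" by (simp add: mult_ac)
  moreover have "int (ord x) \<noteq> 0" using k N0 by (cases "ord x = 0") auto
  ultimately have "g dvd j" by (metis dvd_mult_cancel_left dvd_mult_left)
  then obtain j' where j': "j = g * j'" by auto
  obtain u v where uv: "u * i + v * int (ord c) = g"
    using bezout_int g_def by blast
  have "j = i * (u * j') + int (ord c) * (v * j')"
    unfolding j' uv[symmetric] by (simp add: algebra_simps)
  moreover have "c [^] (int (ord c) * (v * j')) = \<one>" using c int_pow_eq_id by auto
  ultimately have "w = x [^] (u * j')"
    using c by (simp add: ij int_pow_mult int_pow_pow)
  then show ?thesis using generate_pow[of x] ij c by auto
qed

section \<open>Elements of coprime order in nilpotent groups\<close>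

text \<open>The commutator \<open>k\<close> commutes with \<open>x\<close> and \<open>y\<close>, so
  the commutator of \<open>x [^] n\<close> and \<open>y\<close>, like that of \<open>x\<close> and
  \<open>y [^] n\<close>, is \<open>k [^] n\<close>. Hence both \<open>a\<close> and
  \<open>b\<close> kill \<open>k\<close>.\<close>

lemma commute_if_central_commutator:
  fixes a b :: nat
  assumes carr: "x \<in> carrier G" "y \<in> carrier G" "k \<in> carrier G"
    and k: "x \<otimes> y = k \<otimes> (y \<otimes> x)" "k \<otimes> x = x \<otimes> k" "k \<otimes> y = y \<otimes> k"
    and cop: "coprime a b" "x [^] a = \<one>" "y [^] b = \<one>"
  shows "x \<otimes> y = y \<otimes> x"
proof -
  have kx: "x [^] n \<otimes> k = k \<otimes> x [^] n" for n :: nat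
    using group_commutes_pow[of x k n] k carr by simp
  have ky: "y [^] n \<otimes> k = k \<otimes> y [^] n" for n :: nat
    using group_commutes_pow[of y k n] k carr by simp
  have X: "x [^] n \<otimes> y = k [^] n \<otimes> (y \<otimes> x [^] n)" for n :: nat
  proof (induction n)
    case (Suc n)
    have "x [^] Suc n \<otimes> y = x [^] n \<otimes> (k \<otimes> (y \<otimes> x))" using carr k(1) by (simp add: m_assoc)
    also have "\<dots> = k \<otimes> (x [^] n \<otimes> y) \<otimes> x" using carr kx[of n] by (simp flip: m_assoc)
    also have "\<dots> = k \<otimes> k [^] n \<otimes> (y \<otimes> (x [^] n \<otimes> x))" using carr Suc by (simp add: m_assoc)
    finally show ?case using carr nat_pow_Suc2 by simp
  qed (use carr in simp)
  have Y: "x \<otimes> y [^] n = k [^] n \<otimes> (y [^] n \<otimes> x)" for n :: nat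
  proof (induction n)
    case (Suc n)
    have "x \<otimes> y [^] Suc n = k [^] n \<otimes> (y [^] n \<otimes> (x \<otimes> y))"
      using carr Suc by (simp flip: m_assoc)
    also have "\<dots> = k [^] n \<otimes> ((y [^] n \<otimes> k) \<otimes> (y \<otimes> x))"
      using carr k(1) by (simp add: m_assoc)
    also note ky
    finally show ?case using carr by (simp add: m_assoc)
  qed (use carr in simp)
  have "k [^] a = \<one>" using X[of a] carr cop by simp
  moreover have "k [^] b = \<one>" using Y[of b] carr cop by simp
  ultimately have "k = \<one>" using eq_one_if_coprime_pows cop(1) carr by blast
  then show ?thesis using k carr by simp
qed

text \<open>Conjugation is an automorphism, so by induction it maps the generating commutators to
  generating commutators. Normality is what makes the quotients by these terms available.\<close>

lemma lower_central_series_normal: "lower_central_series G n \<lhd> G"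
proof (induction n)
  case 0
  show ?case by (simp add: normal_inv_iff subgroup_self)
next
  case (Suc n)
  let ?L = "lower_central_series G n"
  interpret N: normal ?L G by (rule Suc)
  show ?case unfolding lower_central_series.simps
  proof (rule normal_generateI)
    show "(\<Union>x\<in>carrier G. \<Union>y\<in>?L. {x \<otimes> y \<otimes> inv x \<otimes> inv y}) \<subseteq> carrier G"
      using N.subset by auto
    fix h g
    assume "h \<in> (\<Union>x\<in>carrier G. \<Union>y\<in>?L. {x \<otimes> y \<otimes> inv x \<otimes> inv y})" and g: "g \<in> carrier G"
    then obtain x y where xy: "x \<in> carrier G" "y \<in> ?L" and h: "h = x \<otimes> y \<otimes> inv x \<otimes> inv y"
      by auto
    have y: "y \<in> carrier G" using xy N.subset by auto
    let ?x = "g \<otimes> x \<otimes> inv g" and ?y = "g \<otimes> y \<otimes> inv g"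
    have "g \<otimes> h \<otimes> inv g = ?x \<otimes> ?y \<otimes> inv ?x \<otimes> inv ?y"
      using g xy y by (simp add: h m_assoc inv_mult_group inv_cancel_left)
    moreover have "?y \<in> ?L" using xy g N.inv_op_closed2 by auto
    ultimately show "g \<otimes> h \<otimes> inv g \<in> (\<Union>x\<in>carrier G. \<Union>y\<in>?L. {x \<otimes> y \<otimes> inv x \<otimes> inv y})"
      using xy g by (intro UN_I[of ?x] UN_I[of ?y]) auto
  qed
qed

text \<open>The commutator \<open>k\<close> lies in every term of the lower central series. Once it
  lies in one term, it becomes central modulo the next, where the previous lemma makes it
  trivial.\<close>

lemma nilpotent_commute_if_coprime:
  fixes a b :: nat
  assumes nil: "nilpotent_group G" and carr: "x \<in> carrier G" "y \<in> carrier G"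
    and cop: "coprime a b" "x [^] a = \<one>" "y [^] b = \<one>"
  shows "x \<otimes> y = y \<otimes> x"
proof -
  define k where "k = x \<otimes> y \<otimes> inv x \<otimes> inv y"
  have k: "k \<in> carrier G" using carr by (simp add: k_def)
  have kxy: "x \<otimes> y = k \<otimes> (y \<otimes> x)"
    using carr by (simp add: k_def m_assoc inv_cancel_left)
  have "k \<in> lower_central_series G n" for n
  proof (induction n)
    case 0
    then show ?case using k by simp
  next
    case (Suc n)
    define L where "L = lower_central_series G (Suc n)"
    interpret N: normal L G unfolding L_def by (rule lower_central_series_normal)
    interpret Q: group "G Mod L" by (rule N.factorgroup_is_group)
    interpret h: group_hom G "G Mod L" "\<lambda>t. L #> t"
      using N.r_coset_hom_Mod by unfold_locales
    have cent: "(L #> k) \<otimes>\<^bsub>G Mod L\<^esub> (L #> t) = (L #> t) \<otimes>\<^bsub>G Mod L\<^esub> (L #> k)"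
      if t: "t \<in> carrier G" for t
    proof -
      let ?d = "t \<otimes> k \<otimes> inv t \<otimes> inv k"
      \<comment> \<open>As \<open>k\<close> is in term \<open>n\<close> by induction,
        \<open>?d\<close> is one of the commutators generating term \<open>Suc n\<close>.\<close>
      have "?d \<in> L" unfolding L_def lower_central_series.simps
        using Suc t by (intro generate.incl) blast
      then have "L #> ?d = \<one>\<^bsub>G Mod L\<^esub>"
        using t k coset_join2[OF _ N.subgroup_axioms] by (simp add: FactGroup_def)
      moreover have "t \<otimes> k = ?d \<otimes> (k \<otimes> t)"
        using t k by (simp add: m_assoc inv_cancel_left)
      ultimately have "L #> (t \<otimes> k) = \<one>\<^bsub>G Mod L\<^esub> \<otimes>\<^bsub>G Mod L\<^esub> (L #> (k \<otimes> t))"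
        using t k h.hom_mult[of ?d "k \<otimes> t"] by simp
      then have "L #> (t \<otimes> k) = L #> (k \<otimes> t)"
        using t k h.hom_closed[of "k \<otimes> t"] Q.l_one by (metis m_closed)
      then show ?thesis using t k h.hom_mult by metis
    qed
    have "(L #> x) \<otimes>\<^bsub>G Mod L\<^esub> (L #> y) = (L #> y) \<otimes>\<^bsub>G Mod L\<^esub> (L #> x)"
    proof (rule Q.commute_if_central_commutator[OF _ _ _ _ cent[OF carr(1)] cent[OF carr(2)] cop(1)])
      show "L #> x \<in> carrier (G Mod L)" "L #> y \<in> carrier (G Mod L)" "L #> k \<in> carrier (G Mod L)"
        using carr k h.hom_closed by blast+
      show "(L #> x) \<otimes>\<^bsub>G Mod L\<^esub> (L #> y) =
          (L #> k) \<otimes>\<^bsub>G Mod L\<^esub> ((L #> y) \<otimes>\<^bsub>G Mod L\<^esub> (L #> x))"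
        using carr k kxy h.hom_mult[of x y] h.hom_mult[of y x] h.hom_mult[of k "y \<otimes> x"] by simp
      show "(L #> x) [^]\<^bsub>G Mod L\<^esub> a = \<one>\<^bsub>G Mod L\<^esub>"
        using carr cop h.hom_nat_pow[of x a] h.hom_one by simp
      show "(L #> y) [^]\<^bsub>G Mod L\<^esub> b = \<one>\<^bsub>G Mod L\<^esub>"
        using carr cop h.hom_nat_pow[of y b] h.hom_one by simp
    qed
    then have "(L #> k) \<otimes>\<^bsub>G Mod L\<^esub> (L #> (y \<otimes> x)) = L #> (y \<otimes> x)"
      using carr k kxy h.hom_mult[of x y] h.hom_mult[of y x] h.hom_mult[of k "y \<otimes> x"] by simp
    then have "L #> k = \<one>\<^bsub>G Mod L\<^esub>"
      using carr k h.hom_closed Q.r_cancel_one by (metis m_closed)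
    then have "L #> k = L" by (simp add: FactGroup_def)
    then show ?case using coset_join1[OF _ k N.subgroup_axioms] by (simp add: L_def)
  qed
  then have "k = \<one>" using nil by (metis nilpotent_group_def singletonD)
  then show ?thesis using kxy carr by simp
qed

section \<open>Choosing a conjugating element prime by prime\<close>

lemma conj_eq_if_commute:
  assumes "x \<in> carrier G" "g \<in> carrier G" "h \<in> carrier G" "x \<otimes> g = g \<otimes> x"
  shows "inv (g \<otimes> h) \<otimes> x \<otimes> (g \<otimes> h) = inv h \<otimes> x \<otimes> h"
proof -
  have "x \<otimes> (g \<otimes> h) = g \<otimes> (x \<otimes> h)" using assms by (metis m_assoc)
  then show ?thesis using assms by (simp add: inv_mult_group m_assoc inv_cancel_left)
qed

text \<open>The element \<open>f\<close> is the product of the part of \<open>g\<close> of order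
  prime to \<open>q\<close> and the \<open>q\<close>-part of \<open>h\<close>. In each case the
  other parts commute with \<open>x\<close> and have no effect on it.\<close>

lemma ex_conj_combining_primary_parts:
  assumes fin: "finite (carrier G)" and nil: "nilpotent_group G"
    and q: "prime (q::nat)" and g: "g \<in> carrier G" and h: "h \<in> carrier G"
  obtains f where "f \<in> carrier G"
    "\<And>x k. x \<in> carrier G \<Longrightarrow> x [^] (q ^ k) = \<one> \<Longrightarrow> inv f \<otimes> x \<otimes> f = inv h \<otimes> x \<otimes> h"
    "\<And>p x k. prime (p::nat) \<Longrightarrow> p \<noteq> q \<Longrightarrow> x \<in> carrier G \<Longrightarrow> x [^] (p ^ k) = \<one> \<Longrightarrow>
      inv f \<otimes> x \<otimes> f = inv g \<otimes> x \<otimes> g"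
proof -
  have "order G > 0" using fin by (simp add: order_gt_0_iff_finite)
  then obtain m where m: "order G = q ^ multiplicity q (order G) * m" "\<not> q dvd m"
    using multiplicity_decompose'[of "order G" q] q by (metis not_prime_unit neq0_conv)
  define e where "e = multiplicity q (order G)"
  have cop: "coprime m (q ^ e)" using q m by (metis prime_imp_coprime coprime_commute coprime_power_right_iff)
  have ord: "m * q ^ e = order G" using m by (metis e_def mult.commute)
  have ex: "\<exists>s t. s \<in> carrier G \<and> t \<in> carrier G \<and> y = s \<otimes> t \<and> y = t \<otimes> s \<and>
      s [^] m = \<one> \<and> t [^] (q ^ e) = \<one>" if y: "y \<in> carrier G" for y
  proof -
    have "y [^] (m * q ^ e) = \<one>" using pow_order_eq_1 y ord by simp
    then obtain u v :: int where uv: "y = y [^] u \<otimes> y [^] v"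
        "(y [^] u) [^] m = \<one>" "(y [^] v) [^] (q ^ e) = \<one>"
      using coprime_power_decomp[OF cop y] by blast
    moreover have "y [^] u \<otimes> y [^] v = y [^] v \<otimes> y [^] u"
      using y by (simp add: int_pow_mult[symmetric] add.commute)
    ultimately show ?thesis using y by (metis int_pow_closed)
  qed
  \<comment> \<open>The factors of \<open>g\<close> and \<open>h\<close> are ordered oppositely, so
    that in both the part commuting with the relevant \<open>x\<close> stands on the left, as
    \<open>conj_eq_if_commute\<close> requires.\<close>
  obtain g1 g2 where g12: "g1 \<in> carrier G" "g2 \<in> carrier G" "g = g2 \<otimes> g1"
      "g1 [^] m = \<one>" "g2 [^] (q ^ e) = \<one>"
    using ex[OF g] by blast
  obtain h1 h2 where h12: "h1 \<in> carrier G" "h2 \<in> carrier G" "h = h1 \<otimes> h2"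
      "h1 [^] m = \<one>" "h2 [^] (q ^ e) = \<one>"
    using ex[OF h] by blast
  have comm: "g1 \<otimes> h2 = h2 \<otimes> g1"
    using nilpotent_commute_if_coprime[OF nil _ _ cop] g12 h12 by blast
  show ?thesis
  proof (rule that[of "g1 \<otimes> h2"])
    show "g1 \<otimes> h2 \<in> carrier G" using g12 h12 by simp
  next
    fix x k assume x: "x \<in> carrier G" "x [^] (q ^ k) = \<one>"
    have "coprime (q ^ k) m" using q m by (simp add: prime_imp_coprime)
    then have "x \<otimes> g1 = g1 \<otimes> x" "x \<otimes> h1 = h1 \<otimes> x"
      using nilpotent_commute_if_coprime[OF nil] x g12 h12 by blast+
    then show "inv (g1 \<otimes> h2) \<otimes> x \<otimes> (g1 \<otimes> h2) = inv h \<otimes> x \<otimes> h"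
      using conj_eq_if_commute x g12 h12 by simp
  next
    fix p x k assume p: "prime (p::nat)" "p \<noteq> q" and x: "x \<in> carrier G" "x [^] (p ^ k) = \<one>"
    have "coprime (p ^ k) (q ^ e)" using p q by (simp add: primes_coprime)
    then have "x \<otimes> h2 = h2 \<otimes> x" "x \<otimes> g2 = g2 \<otimes> x"
      using nilpotent_commute_if_coprime[OF nil] x g12 h12 by blast+
    then show "inv (g1 \<otimes> h2) \<otimes> x \<otimes> (g1 \<otimes> h2) = inv g \<otimes> x \<otimes> g"
      using conj_eq_if_commute x g12 h12 comm by simp
  qed
qed

text \<open>Take a violating \<open>q\<close>-element \<open>w\<close> of least order. It lies in
  the subgroup generated by any other violating one, so a conjugate of \<open>c\<close> not
  commuting with \<open>w\<close> commutes with none of them.\<close>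

lemma ex_conj_for_prime:
  assumes fin: "finite (carrier G)" and c: "c \<in> carrier G" and q: "prime (q::nat)"
  shows "\<exists>g\<in>carrier G. \<forall>x k. x \<in> generate G {c} \<longrightarrow> x [^] (q ^ k) = \<one> \<longrightarrow>
    x \<in> centralizer G (g \<otimes> c \<otimes> inv g) \<longrightarrow> (\<forall>z\<in>conjugacy_class G c. x \<in> centralizer G z)"
proof -
  define bad where "bad x \<longleftrightarrow> x \<in> generate G {c} \<and> (\<exists>k. x [^] (q ^ k) = \<one>) \<and>
    \<not> (\<forall>z\<in>conjugacy_class G c. x \<in> centralizer G z)" for x
  show ?thesis
  proof (cases "\<exists>x. bad x")
    case False
    then show ?thesis using bad_def by blast
  next
    case True
    then obtain w where w: "bad w" and least: "\<And>x. bad x \<Longrightarrow> ord w \<le> ord x"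
      using ex_has_least_nat[of bad _ ord] by blast
    obtain g where g: "g \<in> carrier G" and wg: "w \<notin> centralizer G (g \<otimes> c \<otimes> inv g)"
      using w by (auto simp: bad_def conjugacy_class_def)
    have carr: "x \<in> carrier G" if "bad x" for x
      using that c generate_in_carrier[of "{c}"] by (auto simp: bad_def)
    have primepow: "\<exists>k. ord x = q ^ k" if x: "bad x" for x
      using x carr[OF x] pow_eq_id[of x] divides_primepow_nat[OF q] by (auto simp: bad_def)
    have "x \<notin> centralizer G (g \<otimes> c \<otimes> inv g)" if x: "bad x" for x
    proof
      assume "x \<in> centralizer G (g \<otimes> c \<otimes> inv g)"
      then have "generate G {x} \<subseteq> centralizer G (g \<otimes> c \<otimes> inv g)"
        using generate_subgroup_incl subgroup_centralizer c g by simp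
      \<comment> \<open>Both orders are powers of \<open>q\<close>, so the smaller one divides the
        larger.\<close>
      moreover have "ord w dvd ord x"
        using primepow[OF w] primepow[OF x] least[OF x] prime_gt_1_nat[OF q]
        by (auto simp: le_imp_power_dvd)
      then have "w \<in> generate G {x}"
        using generate_mem_if_pow_ord[OF c] w x carr[OF w] pow_eq_id ord_ge_1[OF fin c]
        by (simp add: bad_def)
      ultimately show False using wg by blast
    qed
    then show ?thesis using g bad_def by blast
  qed
qed

text \<open>Induction on \<open>S\<close>: the conjugator \<open>g\<close> for the old primes and
  \<open>h\<close> for the new prime \<open>q\<close> are merged into one \<open>f\<close> acting
  like each of them on the elements that matter.\<close>

lemma ex_conj_for_primes:
  assumes fin: "finite (carrier G)" and nil: "nilpotent_group G" and c: "c \<in> carrier G"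
    and S: "finite S" "\<And>p. p \<in> S \<Longrightarrow> prime (p::nat)"
  shows "\<exists>g\<in>carrier G. \<forall>p\<in>S. \<forall>x k. x \<in> generate G {c} \<longrightarrow> x [^] (p ^ k) = \<one> \<longrightarrow>
    x \<in> centralizer G (g \<otimes> c \<otimes> inv g) \<longrightarrow> (\<forall>z\<in>conjugacy_class G c. x \<in> centralizer G z)"
  using S
proof (induction S rule: finite_induct)
  case empty
  then show ?case by auto
next
  case (insert q S)
  have q: "prime q" using insert by auto
  obtain g where g: "g \<in> carrier G" and gS: "\<forall>p\<in>S. \<forall>x k. x \<in> generate G {c} \<longrightarrow> x [^] (p ^ k) = \<one> \<longrightarrow>
      x \<in> centralizer G (g \<otimes> c \<otimes> inv g) \<longrightarrow> (\<forall>z\<in>conjugacy_class G c. x \<in> centralizer G z)"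
    using insert by auto
  obtain h where h: "h \<in> carrier G" and hq: "\<forall>x k. x \<in> generate G {c} \<longrightarrow> x [^] (q ^ k) = \<one> \<longrightarrow>
      x \<in> centralizer G (h \<otimes> c \<otimes> inv h) \<longrightarrow> (\<forall>z\<in>conjugacy_class G c. x \<in> centralizer G z)"
    using ex_conj_for_prime[OF fin c q] by blast
  obtain f where f: "f \<in> carrier G"
    and fq: "\<And>x k. x \<in> carrier G \<Longrightarrow> x [^] (q ^ k) = \<one> \<Longrightarrow> inv f \<otimes> x \<otimes> f = inv h \<otimes> x \<otimes> h"
    and fp: "\<And>p x k. prime p \<Longrightarrow> p \<noteq> q \<Longrightarrow> x \<in> carrier G \<Longrightarrow> x [^] (p ^ k) = \<one> \<Longrightarrow>
      inv f \<otimes> x \<otimes> f = inv g \<otimes> x \<otimes> g"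
    using ex_conj_combining_primary_parts[OF fin nil q g h] by metis
  have carr: "x \<in> carrier G" if "x \<in> generate G {c}" for x
    using that c generate_in_carrier[of "{c}"] by auto
  show ?case
  proof (intro bexI[OF _ f] ballI allI impI)
    fix p x k z
    assume p: "p \<in> insert q S" and x: "x \<in> generate G {c}" "x [^] (p ^ k) = \<one>"
      and xf: "x \<in> centralizer G (f \<otimes> c \<otimes> inv f)" and z: "z \<in> conjugacy_class G c"
    \<comment> \<open>With this, \<open>fq\<close> and \<open>fp\<close> allow \<open>f\<close> to
      be exchanged for \<open>h\<close> or \<open>g\<close> in the centralizer condition.\<close>
    note conj = mem_centralizer_conj[OF carr[OF x(1)] _ c]
    show "x \<in> centralizer G z"
    proof (cases "p = q")
      case True
      then have "x \<in> centralizer G (h \<otimes> c \<otimes> inv h)"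
        using xf conj[OF f] conj[OF h] fq carr x by metis
      then show ?thesis using hq x z True by blast
    next
      case False
      then have "x \<in> centralizer G (g \<otimes> c \<otimes> inv g)"
        using xf conj[OF f] conj[OF g] fp carr x p insert.prems by metis
      then show ?thesis using gS x z p False by blast
    qed
  qed
qed

section \<open>Conjugacy classes and the center of the generated subgroup\<close>

lemma conjugacy_class_eq:
  assumes "x \<in> carrier G" "c \<in> conjugacy_class G x"
  shows "conjugacy_class G c = conjugacy_class G x"
proof -
  obtain t where t: "t \<in> carrier G" "c = t \<otimes> x \<otimes> inv t"
    using assms by (auto simp: conjugacy_class_def)
  have c: "c \<in> carrier G" using t assms(1) by simp
  have x: "x = inv t \<otimes> c \<otimes> t"
    unfolding t(2) using t(1) assms(1) by (simp add: m_assoc inv_cancel_left)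
  show ?thesis
    unfolding conjugacy_class_def
  proof (intro subset_antisym image_subsetI)
    fix g assume g: "g \<in> carrier G"
    have "g \<otimes> c \<otimes> inv g = (g \<otimes> t) \<otimes> x \<otimes> inv (g \<otimes> t)"
      unfolding t(2) using g t(1) assms(1) by (simp add: m_assoc inv_mult_group)
    then show "g \<otimes> c \<otimes> inv g \<in> (\<lambda>g. g \<otimes> x \<otimes> inv g) ` carrier G"
      using g t(1) by blast
    have "g \<otimes> x \<otimes> inv g = (g \<otimes> inv t) \<otimes> c \<otimes> inv (g \<otimes> inv t)"
      unfolding x using g t(1) c by (simp add: m_assoc inv_mult_group)
    then show "g \<otimes> x \<otimes> inv g \<in> (\<lambda>g. g \<otimes> c \<otimes> inv g) ` carrier G"
      using g t(1) by blast
  qed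
qed

text \<open>Commuting is symmetric, so \<open>C\<close> lies in the subgroup
  \<open>centralizer G x\<close>, which then contains all of \<open>generate G C\<close>.\<close>

lemma mem_center_subgroup_generated:
  assumes C: "C \<subseteq> carrier G" and x: "x \<in> generate G C" and comm: "\<And>z. z \<in> C \<Longrightarrow> x \<in> centralizer G z"
  shows "x \<in> group_center (subgroup_generated G C)"
proof -
  have xc: "x \<in> carrier G" using generate_in_carrier[OF C x] .
  have "C \<subseteq> centralizer G x" using C comm by (auto simp: centralizer_def)
  then have "generate G C \<subseteq> centralizer G x"
    using generate_subgroup_incl subgroup_centralizer[OF xc] by blast
  then show ?thesis
    using x C by (auto simp: group_center_def centralizer_def carrier_subgroup_generated Int_absorb1)
qed

end

theorem corollary5p2:
  fixes G :: "('a, 'b) monoid_scheme"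
  assumes "group G" and "finite (carrier G)" and "nilpotent_group G"
  shows "good_group G"
proof -
  interpret group G by fact
  have "good_conjugacy_class G (conjugacy_class G x)" if x: "x \<in> carrier G" for x
    unfolding good_conjugacy_class_def
  proof
    let ?C = "conjugacy_class G x"
    fix c assume cC: "c \<in> ?C"
    have C: "?C \<subseteq> carrier G" using x by (auto simp: conjugacy_class_def)
    then have c: "c \<in> carrier G" using cC by auto
    have cl: "conjugacy_class G c = ?C" using conjugacy_class_eq x cC by blast
    have order0: "order G > 0" using assms(2) by (simp add: order_gt_0_iff_finite)
    \<comment> \<open>Only the finitely many prime divisors of the group order are handled by the
      choice of \<open>g\<close>.\<close>
    obtain g where g: "g \<in> carrier G"
      and gp: "\<And>p y k. p \<in> prime_factors (order G) \<Longrightarrow> y \<in> generate G {c} \<Longrightarrow> y [^]\<^bsub>G\<^esub> (p ^ k) = \<one>\<^bsub>G\<^esub> \<Longrightarrow>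
        y \<in> centralizer G (g \<otimes>\<^bsub>G\<^esub> c \<otimes>\<^bsub>G\<^esub> inv\<^bsub>G\<^esub> g) \<Longrightarrow> \<forall>z\<in>?C. y \<in> centralizer G z"
      using ex_conj_for_primes[OF assms(2,3) c finite_set_mset[of "prime_factorization (order G)"]] cl
      by (metis in_prime_factors_imp_prime)
    define z where "z = g \<otimes>\<^bsub>G\<^esub> c \<otimes>\<^bsub>G\<^esub> inv\<^bsub>G\<^esub> g"
    have zC: "z \<in> ?C" unfolding cl[symmetric] using g by (auto simp: z_def conjugacy_class_def)
    have sub: "subgroup (generate G {c} \<inter> centralizer G z) G"
      using generate_is_subgroup[of "{c}"] subgroup_centralizer c zC C
      by (intro subgroups_Inter_pair) auto
    have "generate G {c} \<inter> centralizer G z \<subseteq> group_center (subgroup_generated G ?C)"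
    proof
      fix w assume w: "w \<in> generate G {c} \<inter> centralizer G z"
      then have wc: "w \<in> carrier G" using sub subgroup.mem_carrier by metis
      have "w \<in> centralizer G y" if y: "y \<in> ?C" for y
      \<comment> \<open>Applied to the subgroup \<open>centralizer G y\<close> with exponent
        \<open>order G\<close>, this reduces the claim to powers of \<open>w\<close> of prime power
        order.\<close>
      proof (rule mem_subgroup_if_primary_powers[OF subgroup_centralizer wc pow_order_eq_1[OF wc] order0])
        show "y \<in> carrier G" using y C by auto
        fix p k :: nat and i :: int
        let ?v = "w [^]\<^bsub>G\<^esub> i"
        assume p: "prime p" and v: "?v [^]\<^bsub>G\<^esub> (p ^ k) = \<one>\<^bsub>G\<^esub>"
        have vin: "?v \<in> generate G {c} \<inter> centralizer G z"
          using subgroup_int_pow_closed[OF sub w] .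
        show "?v \<in> centralizer G y"
        proof (cases "p dvd order G")
          case True
          then have "p \<in> prime_factors (order G)" using p order0 by (simp add: prime_factors_dvd)
          then show ?thesis using gp vin v y unfolding z_def by blast
        next
          case False
          \<comment> \<open>For a prime not dividing the group order, the only such power is
            \<open>\<one>\<close>.\<close>
          then have "coprime (p ^ k) (order G)" using p by (simp add: prime_imp_coprime)
          then have "?v = \<one>\<^bsub>G\<^esub>"
            using eq_one_if_coprime_pows v pow_order_eq_1 wc by (metis int_pow_closed)
          then show ?thesis using y C by (auto simp: centralizer_def)
        qed
      qed
      moreover have "w \<in> generate G ?C"
        using w mono_generate[of "{c}" ?C] cC by auto
      ultimately show "w \<in> group_center (subgroup_generated G ?C)"
        using mem_center_subgroup_generated[OF C] by blast
    qed
    then show "\<exists>z\<in>?C. generate G {c} \<inter> centralizer G z \<subseteq> group_center (subgroup_generated G ?C)"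
      using zC by blast
  qed
  then show ?thesis by (auto simp: good_group_def conjugacy_classes_def)
qed

end
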